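(* (i) Let $d\geq 2$ be an integer and $n>1$ an odd integer with $n\equiv -1 \pmod d$. Then $$\sum_{k=0}^{\frac{n+1}{d}}\frac{(q^{-1};q^d)_k}{(q^d;q^d)_k}\,q^{dk}\equiv (-1)^{\frac{n+d+1}{d}}\,[n]_q\,q^{\frac{n^2-dn+d-1}{2d}} \pmod{\Phi_n(q)^2}.$$ Moreover, for a positive integer $d$ and an odd integer $n>1$ with $n\equiv 1\pmod{2d}$, $$\sum_{k=0}^{\frac{n-1}{2d}}\frac{(q;q^{2d})_k}{(q^{2d};q^{2d})_k}\,q^{2dk}\equiv 0 \pmod{\Phi_n(q)}.$$ (ii) Let $d\geq 2$ be an integer, $x\neq 0$ an indeterminate, and $n>1$ an odd integer with $n\equiv -1 \pmod d$. Then $$\sum_{k=0}^{\frac{n+1}{d}}\frac{(q^{-1};q^d)_k\,(x;q^d)_k}{(q^d;q^d)_k\,(q^{d-1}x;q^d)_k}\,q^{dk}\equiv (-1)^{\frac{n+d+1}{d}}\,[n]_q\,q^{-\frac{n^2+dn-d-1}{2d}}\,\frac{((qx)^{-1};q^d)_{(n+1)/d}}{(x^{-1};q^d)_{(n+1)/d}} \pmod{\Phi_n(q)^2}.$$ Moreover, for a positive integer $d$, an indeterminate $x\neq 0$, and an odd integer $n>1$ with $n\equiv 1\pmod{2d}$, $$\sum_{k=0}^{\frac{n-1}{2d}}\frac{(q;q^{2d})_k\,(x;q^{2d})_k}{(q^{2d};q^{2d})_k\,(q^{2d+1}x;q^{2d})_k}\,q^{2dk}\equiv 0 \pmod{\P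hi_n(q)}.$$
   Context: The $q$-shifted factorial is $(a;q)_0=1$ and $(a;q)_k=(1-a)(1-aq)\cdots(1-aq^{k-1})$ for $k\geq 1$. The $q$-integer is $[n]_q=(1-q^n)/(1-q)=1+q+\cdots+q^{n-1}$. $\Phi_n(q)$ denotes the $n$th cyclotomic polynomial. A congruence $A\equiv B \pmod{P(q)}$ between rational functions in $q$ (with coefficients that may involve other indeterminates such as $x$) means that $A-B$ can be written as a quotient whose numerator is divisible by $P(q)$ and whose denominator is coprime to $P(q)$. *)

theory Defs
  imports
    "HOL-Computational_Algebra.Polynomial_Factorial"
    "HOL-Computational_Algebra.Fundamental_Theorem_Algebra"
    "HOL-Number_Theory.Cong"
begin

definition primitive_roots_unity :: "nat \<Rightarrow> complex set" where
  "primitive_roots_unity n = {z. z ^ n = 1 \<and> (\<forall>m. 0 < m \<and> m < n \<longrightarrow> z ^ m \<noteq> 1)}"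

text \<open>The cyclotomic polynomial is kept over the integers so that it can be read over any
  coefficient field; that the description below is satisfied is \<open>of_int_cyclotomic_poly\<close>.\<close>

definition cyclotomic_poly :: "nat \<Rightarrow> int poly" where
  "cyclotomic_poly n =
     (THE p. map_poly of_int p = (\<Prod>z\<in>primitive_roots_unity n. [:- z, 1:]))"

lemma map_poly_of_int_add:
  "map_poly of_int (p + q) = map_poly of_int p + (map_poly of_int q :: 'a::comm_ring_1 poly)"
  by (rule poly_eqI) (simp add: coeff_map_poly)

lemma map_poly_of_int_mult:
  "map_poly of_int (p * q) = map_poly of_int p * (map_poly of_int q :: 'a::comm_ring_1 poly)"
  by (rule poly_eqI) (simp add: coeff_map_poly coeff_mult)

lemma map_poly_of_int_prod:
  "map_poly of_int (\<Prod>i\<in>A. f i) = (\<Prod>i\<in>A. (map_poly of_int (f i) :: 'a::comm_ring_1 poly))"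
  by (induction A rule: infinite_finite_induct) (simp_all add: map_poly_of_int_mult)

lemma map_poly_of_int_inj:
  "map_poly of_int p = (map_poly of_int q :: 'a::{comm_ring_1,ring_char_0} poly) \<longleftrightarrow> p = q"
  by (auto simp: poly_eq_iff coeff_map_poly)

lemma power_eq_1_iff_dvd_primitive:
  assumes "z \<in> primitive_roots_unity d" "d > 0"
  shows "z ^ m = 1 \<longleftrightarrow> d dvd m"
proof -
  have "z ^ m = z ^ (d * (m div d) + m mod d)" by simp
  also have "\<dots> = z ^ (m mod d)"
    using assms by (simp only: power_add power_mult) (simp add: primitive_roots_unity_def)
  finally have eq: "z ^ m = z ^ (m mod d)" .
  have "m mod d < d" using assms by simp
  thus ?thesis
    using assms eq by (cases "m mod d = 0") (auto simp: primitive_roots_unity_def dvd_eq_mod_eq_0)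
qed

lemma roots_unity_decompose:
  assumes "n > 0"
  shows "{z::complex. z ^ n = 1} = (\<Union>d\<in>{d. d dvd n}. primitive_roots_unity d)"
proof (intro equalityI subsetI)
  fix z :: complex assume "z \<in> {z. z ^ n = 1}"
  hence z: "z ^ n = 1" by simp
  define d where "d = (LEAST m. 0 < m \<and> z ^ m = 1)"
  have d: "0 < d \<and> z ^ d = 1"
    unfolding d_def by (rule LeastI[of _ n]) (use z assms in auto)
  moreover have "\<forall>m. 0 < m \<and> m < d \<longrightarrow> z ^ m \<noteq> 1"
    using not_less_Least[of _ "\<lambda>m. 0 < m \<and> z ^ m = 1"] unfolding d_def by blast
  ultimately have *: "z \<in> primitive_roots_unity d" by (simp add: primitive_roots_unity_def)
  with d z have "d dvd n" by (simp add: power_eq_1_iff_dvd_primitive)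
  with * show "z \<in> (\<Union>d\<in>{d. d dvd n}. primitive_roots_unity d)" by blast
next
  fix z assume "z \<in> (\<Union>d\<in>{d. d dvd n}. primitive_roots_unity d)"
  then obtain d where "d dvd n" "z \<in> primitive_roots_unity d" by blast
  thus "z \<in> {z. z ^ n = 1}" using assms
    by (auto simp: power_eq_1_iff_dvd_primitive intro!: Nat.gr0I)
qed

lemma finite_primitive_roots_unity: "n > 0 \<Longrightarrow> finite (primitive_roots_unity n)"
  by (rule finite_subset[OF _ finite_roots_unity[of n]]) (auto simp: primitive_roots_unity_def)

lemma prod_primitive_roots_unity:
  assumes "n > 0"
  shows "(\<Prod>d | d dvd n. \<Prod>z\<in>primitive_roots_unity d. [:- z, 1:]) = monom 1 n - 1"
proof -
  let ?p = "monom 1 n - 1 :: complex poly"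
  have "rsquarefree ?p"
    unfolding rsquarefree_roots
    using assms by (auto simp: pderiv_diff pderiv_monom poly_monom power_0_left split: if_splits)
  hence "smult (lead_coeff ?p) (\<Prod>z | poly ?p z = 0. [:- z, 1:]) = ?p"
    by (rule complex_poly_decompose_rsquarefree)
  moreover have deg: "degree ?p = n"
  proof (rule antisym)
    show "degree ?p \<le> n" by (intro degree_diff_le) (simp_all add: degree_monom_le)
    show "n \<le> degree ?p" by (rule le_degree) (use assms in simp)
  qed
  moreover have "{z. poly ?p z = 0} = (\<Union>d\<in>{d. d dvd n}. primitive_roots_unity d)"
    using assms by (simp add: poly_monom flip: roots_unity_decompose)
  moreover have "(\<Prod>z\<in>(\<Union>d\<in>{d. d dvd n}. primitive_roots_unity d). [:- z, 1:]) =
      (\<Prod>d | d dvd n. \<Prod>z\<in>primitive_roots_unity d. [:- z, 1:])"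
  proof (rule prod.UNION_disjoint)
    show "finite {d. d dvd n}" using assms by simp
    show "\<forall>i\<in>{d. d dvd n}. finite (primitive_roots_unity i)"
      using assms by (auto intro!: finite_primitive_roots_unity Nat.gr0I)
    show "\<forall>i\<in>{d. d dvd n}. \<forall>j\<in>{d. d dvd n}. i \<noteq> j \<longrightarrow>
        primitive_roots_unity i \<inter> primitive_roots_unity j = {}"
    proof (intro ballI impI equals0I)
      fix i j z
      assume ij: "i \<in> {d. d dvd n}" "j \<in> {d. d dvd n}" "i \<noteq> j"
        and z: "z \<in> primitive_roots_unity i \<inter> primitive_roots_unity j"
      have "i > 0" "j > 0" using ij assms by (auto intro!: Nat.gr0I)
      hence "i dvd j" "j dvd i"
        using z by (auto simp: primitive_roots_unity_def simp flip: power_eq_1_iff_dvd_primitive)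
      with ij show False by (simp add: dvd_antisym)
    qed
  qed
  ultimately show ?thesis using assms by simp
qed

lemma ex_int_cyclotomic:
  "n > 0 \<Longrightarrow> \<exists>p. map_poly of_int p = (\<Prod>z\<in>primitive_roots_unity n. [:- z, 1:])"
proof (induction n rule: less_induct)
  case (less n)
  let ?P = "\<lambda>d. \<Prod>z\<in>primitive_roots_unity d. [:- z, 1:]"
  let ?D = "{d. d dvd n \<and> d \<noteq> n}"
  have "\<forall>d\<in>?D. \<exists>p. map_poly of_int p = ?P d"
  proof
    fix d assume d: "d \<in> ?D"
    hence "d \<le> n" using less.prems by (auto dest: dvd_imp_le)
    moreover have "d > 0" using d less.prems by (auto intro!: Nat.gr0I)
    ultimately show "\<exists>p. map_poly of_int p = ?P d"
      using d by (intro less.IH) auto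
  qed
  then obtain f where f: "\<And>d. d \<in> ?D \<Longrightarrow> map_poly of_int (f d) = ?P d" by metis
  define g where "g = (\<Prod>d\<in>?D. f d)"
  have g: "map_poly of_int g = (\<Prod>d\<in>?D. ?P d)"
    unfolding g_def map_poly_of_int_prod using f by (intro prod.cong) auto
  have "lead_coeff (\<Prod>d\<in>?D. ?P d) = 1" by (simp add: lead_coeff_prod)
  hence "lead_coeff (map_poly of_int g :: complex poly) = 1" by (simp add: g)
  hence lg: "lead_coeff g = 1" by (simp add: degree_map_poly coeff_map_poly)
  hence "g \<noteq> 0" by auto
  have fin: "finite ?D"
    by (rule finite_subset[of _ "{d. d dvd n}"]) (use less.prems in auto)
  have "{d. d dvd n} = insert n ?D" by auto
  hence tot: "monom 1 n - 1 = ?P n * (\<Prod>d\<in>?D. ?P d)"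
    using prod_primitive_roots_unity[OF less.prems] fin by simp
  obtain a r where ar: "pseudo_divmod (monom 1 n - 1 :: int poly) g = (a, r)" by fastforce
  have eq: "monom 1 n - 1 = g * a + r" and r: "r = 0 \<or> degree r < degree g"
    using pseudo_divmod[OF \<open>g \<noteq> 0\<close> ar] lg by simp_all
  let ?h = "map_poly of_int :: int poly \<Rightarrow> complex poly"
  have "?h (monom 1 n - 1) = monom 1 n - 1"
    by (rule poly_eqI) (simp add: coeff_map_poly)
  hence eq': "?P n * ?h g = ?h g * ?h a + ?h r"
    using arg_cong[OF eq, of ?h] tot g by (simp add: map_poly_of_int_add map_poly_of_int_mult)
  hence "?h r = ?h g * (?P n - ?h a)" by (simp add: algebra_simps)
  hence dvd: "?h g dvd ?h r" by simp
  have "r = 0"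
  proof (rule ccontr)
    assume "r \<noteq> 0"
    hence "?h r \<noteq> 0" using map_poly_of_int_inj[of r 0, where 'a = complex] by simp
    hence "degree (?h g) \<le> degree (?h r)" using dvd by (rule dvd_imp_degree_le[rotated])
    thus False using r \<open>r \<noteq> 0\<close> by (simp add: degree_map_poly)
  qed
  moreover have "?h g \<noteq> 0"
    using \<open>g \<noteq> 0\<close> map_poly_of_int_inj[of g 0, where 'a = complex] by simp
  ultimately have "?P n = ?h a" using eq' by (simp add: mult.commute)
  thus ?case by metis
qed

lemma of_int_cyclotomic_poly:
  assumes "n > 0"
  shows "map_poly of_int (cyclotomic_poly n) = (\<Prod>z\<in>primitive_roots_unity n. [:- z, 1:])"
proof -
  obtain p where p: "map_poly of_int p = (\<Prod>z\<in>primitive_roots_unity n. [:- z, 1:])"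
    using ex_int_cyclotomic[OF assms] by blast
  show ?thesis
    unfolding cyclotomic_poly_def
  proof (rule theI)
    show "map_poly of_int p = (\<Prod>z\<in>primitive_roots_unity n. [:- z, 1:])" by (rule p)
  next
    fix r :: "int poly"
    assume "map_poly of_int r = (\<Prod>z\<in>primitive_roots_unity n. [:- z, 1:])"
    hence "map_poly of_int r = (map_poly of_int p :: complex poly)" using p by simp
    thus "r = p" by (simp only: map_poly_of_int_inj)
  qed
qed

definition cyclotomic :: "nat \<Rightarrow> 'a::field poly" where
  "cyclotomic n = map_poly of_int (cyclotomic_poly n)"

definition ratfun_cong :: "'a::field poly fract \<Rightarrow> 'a poly fract \<Rightarrow> 'a poly \<Rightarrow> bool" where
  "ratfun_cong A B P \<longleftrightarrow>
     (\<exists>N D. D \<noteq> 0 \<and> P dvd N \<and> coprime D P \<and> A - B = Fract N D)"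

definition qpoch :: "'a::comm_ring_1 \<Rightarrow> 'a \<Rightarrow> nat \<Rightarrow> 'a" where
  "qpoch a q k = (\<Prod>i<k. 1 - a * q ^ i)"

definition qint :: "'a::field \<Rightarrow> nat \<Rightarrow> 'a" where
  "qint q n = (1 - q ^ n) / (1 - q)"

text \<open>The field \<open>\<rat>(q)\<close> is \<^typ>\<open>rat poly fract\<close>, and \<open>\<rat>(x)(q)\<close> is
  \<^typ>\<open>rat poly fract poly fract\<close>: rational functions in \<open>q\<close> (outer layer) whose coefficients
  are rational functions in \<open>x\<close> (inner layer).\<close>

definition ratfun_q :: "'a::field poly fract" where
  "ratfun_q = Fract [:0, 1:] 1"

definition ratfun_x :: "'a::field poly fract poly fract" where
  "ratfun_x = Fract [:Fract [:0, 1:] 1:] 1"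

end

theory Submission
  imports Defs
begin

text \<open>With \<open>p = q\<^sup>d\<close>, all four sums are instances of the telescoping evaluation
  \[\sum_{k=0}^m \frac{(a;p)_k (b;p)_k}{(p;p)_k (abp;p)_k} p^k
     = \frac{(ap;p)_m (bp;p)_m}{(p;p)_m (abp;p)_m}.\]
  For the given \<open>a\<close> and \<open>m\<close> the last factor of \<open>(ap;p)\<^sub>m\<close> is \<open>1 - q\<^sup>n\<close>, which \<open>\<Phi>\<^sub>n\<close> divides,
  while all denominators are units modulo \<open>\<Phi>\<^sub>n\<close>. This gives the vanishing modulo \<open>\<Phi>\<^sub>n\<close>;
  modulo \<open>\<Phi>\<^sub>n\<^sup>2\<close> it remains to know the cofactor modulo \<open>\<Phi>\<^sub>n\<close>, where \<open>q\<^sup>n = 1\<close> lets one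
  reverse the order of the factors of each shifted factorial.\<close>

section \<open>Localisation at an element\<close>

text \<open>Bezout form of coprimality, since \<open>'a poly\<close> is not an instance of the gcd
  classes for an arbitrary field \<open>'a\<close>.\<close>

definition invertible_mod :: "'a::comm_ring_1 \<Rightarrow> 'a \<Rightarrow> bool" where
  "invertible_mod P D \<longleftrightarrow> (\<exists>u. P dvd u * D - 1)"

lemma invertible_mod_mult:
  assumes "invertible_mod P D" "invertible_mod P E"
  shows "invertible_mod P (D * E)"
proof -
  obtain u v where "P dvd u * D - 1" "P dvd v * E - 1"
    using assms by (auto simp: invertible_mod_def)
  moreover have "(u * v) * (D * E) - 1 = (u * D - 1) * (v * E) + (v * E - 1)"
    by (simp add: algebra_simps)
  ultimately show ?thesis unfolding invertible_mod_def by (metis dvd_add dvd_mult2)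
qed

lemma invertible_mod_one [simp]: "invertible_mod P 1"
  unfolding invertible_mod_def by (rule exI[of _ 1]) simp

text \<open>One Newton step lifts the inverse: if \<open>u\<close> inverts \<open>D\<close> modulo
  \<open>P\<close>, then \<open>u * (2 - u * D)\<close> inverts it modulo
  \<open>P ^ 2\<close>.\<close>

lemma invertible_mod_square:
  assumes "invertible_mod P D"
  shows "invertible_mod (P ^ 2) D"
proof -
  obtain u where "P dvd u * D - 1" using assms by (auto simp: invertible_mod_def)
  hence "P ^ 2 dvd - ((u * D - 1) ^ 2)" by (simp add: dvd_power_same)
  also have "- ((u * D - 1) ^ 2) = (u * (2 - u * D)) * D - 1"
    by (simp add: algebra_simps power2_eq_square)
  finally show ?thesis unfolding invertible_mod_def by blast
qed

text \<open>Translates Bezout into the \<open>coprime\<close> that \<open>ratfun_cong\<close> asks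
  for: a common divisor of \<open>D\<close> and \<open>P\<close> divides both \<open>u * D\<close>
  and \<open>u * D - 1\<close>, hence 1.\<close>

lemma invertible_mod_imp_coprime:
  assumes "invertible_mod P (D :: 'a::field poly)"
  shows "coprime D P"
proof (rule coprimeI)
  fix c assume c: "c dvd D" "c dvd P"
  obtain u where "P dvd u * D - 1" using assms by (auto simp: invertible_mod_def)
  hence "c dvd u * D - 1" using c(2) by (rule dvd_trans[rotated])
  moreover have "c dvd u * D" using c(1) by simp
  ultimately have "c dvd u * D - (u * D - 1)" by (rule dvd_diff[rotated])
  thus "is_unit c" by simp
qed

text \<open>The localisation at the elements invertible modulo \<open>P\<close>, realised inside the
  fraction field so that q-series can be handled there as ordinary quotients.\<close>

definition local_ring :: "'a::idom \<Rightarrow> 'a fract set" where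
  "local_ring P = {to_fract N / to_fract D |N D. D \<noteq> 0 \<and> invertible_mod P D}"

lemma local_ringI:
  "D \<noteq> 0 \<Longrightarrow> invertible_mod P D \<Longrightarrow> to_fract N / to_fract D \<in> local_ring P"
  by (auto simp: local_ring_def)

lemma to_fract_in_local_ring [simp, intro]: "to_fract N \<in> local_ring P"
  using local_ringI[of 1 P N] by simp

lemma local_ring_inverse:
  "invertible_mod P D \<Longrightarrow> inverse (to_fract D) \<in> local_ring P"
  using local_ringI[of D P 1] to_fract_in_local_ring[of 0 P]
  by (cases "D = 0") (auto simp: field_simps)

lemma local_ring_add:
  assumes "A \<in> local_ring P" "B \<in> local_ring P"
  shows "A + B \<in> local_ring P"
proof -
  from assms obtain N D N' D' where
    *: "A = to_fract N / to_fract D" "D \<noteq> 0" "invertible_mod P D"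
       "B = to_fract N' / to_fract D'" "D' \<noteq> 0" "invertible_mod P D'"
    by (auto simp: local_ring_def)
  hence "A + B = to_fract (N * D' + N' * D) / to_fract (D * D')"
    by (simp add: field_simps)
  thus ?thesis using * by (simp only:) (intro local_ringI invertible_mod_mult; simp)
qed

lemma local_ring_mult:
  assumes "A \<in> local_ring P" "B \<in> local_ring P"
  shows "A * B \<in> local_ring P"
proof -
  from assms obtain N D N' D' where
    *: "A = to_fract N / to_fract D" "D \<noteq> 0" "invertible_mod P D"
       "B = to_fract N' / to_fract D'" "D' \<noteq> 0" "invertible_mod P D'"
    by (auto simp: local_ring_def)
  hence "A * B = to_fract (N * N') / to_fract (D * D')"
    by simp
  thus ?thesis using * by (simp only:) (intro local_ringI invertible_mod_mult; simp)
qed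

lemma local_ring_one [simp]: "1 \<in> local_ring P"
  using to_fract_in_local_ring[of 1 P] by simp

lemma local_ring_zero [simp]: "0 \<in> local_ring P"
  using to_fract_in_local_ring[of 0 P] by simp

lemma local_ring_uminus: "A \<in> local_ring P \<Longrightarrow> - A \<in> local_ring P"
  using local_ring_mult[OF to_fract_in_local_ring[of "-1"]] by force

lemma local_ring_diff: "A \<in> local_ring P \<Longrightarrow> B \<in> local_ring P \<Longrightarrow> A - B \<in> local_ring P"
  using local_ring_add[OF _ local_ring_uminus] by fastforce

lemma local_ring_prod:
  "(\<And>i. i \<in> S \<Longrightarrow> f i \<in> local_ring P) \<Longrightarrow> prod f S \<in> local_ring P"
  by (induction S rule: infinite_finite_induct) (auto intro: local_ring_mult)

lemma local_ring_power: "A \<in> local_ring P \<Longrightarrow> A ^ k \<in> local_ring P"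
  by (induction k) (auto intro: local_ring_mult)

lemmas local_ring_intros =
  local_ring_one local_ring_add local_ring_mult local_ring_uminus local_ring_diff local_ring_prod local_ring_power

text \<open>Congruence modulo the ideal that \<open>P\<close> generates in
  \<open>local_ring P\<close>. Only the difference is constrained; \<open>A\<close> and
  \<open>B\<close> may lie outside the ring, which is why the product rule carries membership
  hypotheses.\<close>

definition local_cong :: "'a::idom \<Rightarrow> 'a fract \<Rightarrow> 'a fract \<Rightarrow> bool" where
  "local_cong P A B \<longleftrightarrow> (\<exists>C\<in>local_ring P. A - B = to_fract P * C)"

lemma local_cong_refl [simp]: "local_cong P A A"
  unfolding local_cong_def by (rule bexI[of _ 0]) auto

lemma local_cong_sym: "local_cong P A B \<Longrightarrow> local_cong P B A"
  unfolding local_cong_def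
  by (metis local_ring_uminus minus_diff_eq mult_minus_right)

lemma local_cong_trans [trans]:
  assumes "local_cong P A B" "local_cong P B C"
  shows "local_cong P A C"
proof -
  obtain U V where "U \<in> local_ring P" "V \<in> local_ring P"
    "A - B = to_fract P * U" "B - C = to_fract P * V"
    using assms by (auto simp: local_cong_def)
  moreover from this have "A - C = to_fract P * (U + V)"
    by (simp add: algebra_simps)
  ultimately show ?thesis unfolding local_cong_def by (metis local_ring_add)
qed

text \<open>Splitting the difference as \<open>(A - A') * B + A' * (B - B')\<close> shows that one
  member of each pair in the ring is enough.\<close>

lemma local_cong_mult:
  assumes "local_cong P A A'" "local_cong P B B'" "A' \<in> local_ring P" "B \<in> local_ring P"
  shows "local_cong P (A * B) (A' * B')"
proof -
  obtain U V where "U \<in> local_ring P" "V \<in> local_ring P"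
    "A - A' = to_fract P * U" "B - B' = to_fract P * V"
    using assms by (auto simp: local_cong_def)
  moreover have "A * B - A' * B' = (A - A') * B + A' * (B - B')"
    by (simp add: algebra_simps)
  ultimately have "A * B - A' * B' = to_fract P * (U * B + A' * V)"
    by (simp add: algebra_simps)
  moreover have "U * B + A' * V \<in> local_ring P"
    using assms \<open>U \<in> _\<close> \<open>V \<in> _\<close> by (intro local_ring_intros)
  ultimately show ?thesis unfolding local_cong_def by blast
qed

lemma local_cong_inverse:
  assumes "local_cong P A B" "inverse A \<in> local_ring P" "inverse B \<in> local_ring P"
    and "A \<noteq> 0" "B \<noteq> 0"
  shows "local_cong P (inverse A) (inverse B)"
proof -
  obtain U where U: "U \<in> local_ring P" "A - B = to_fract P * U"
    using assms by (auto simp: local_cong_def)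
  have "inverse A - inverse B = - (A - B) * (inverse A * inverse B)"
    using assms by (simp add: field_simps)
  also have "\<dots> = to_fract P * (- U * (inverse A * inverse B))"
    by (simp add: U(2))
  finally show ?thesis unfolding local_cong_def
    using assms U by (intro bexI[of _ "- U * (inverse A * inverse B)"]) (auto intro!: local_ring_intros)
qed

lemma local_cong_divide:
  assumes "local_cong P A A'" "local_cong P B B'" "A' \<in> local_ring P"
    and "inverse B \<in> local_ring P" "inverse B' \<in> local_ring P" "B \<noteq> 0" "B' \<noteq> 0"
  shows "local_cong P (A / B) (A' / B')"
  unfolding divide_inverse using assms by (intro local_cong_mult local_cong_inverse)

lemma local_cong_diff_left:
  "local_cong P A B \<Longrightarrow> local_cong P (C - A) (C - B)"
  unfolding local_cong_def
  by (metis diff_diff_eq2 add_diff_cancel_left' diff_add_cancel diff_diff_eq local_cong_def local_cong_sym)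

lemma local_cong_prod:
  assumes "\<And>i. i \<in> S \<Longrightarrow> local_cong P (f i) (g i)"
    and "\<And>i. i \<in> S \<Longrightarrow> f i \<in> local_ring P" "\<And>i. i \<in> S \<Longrightarrow> g i \<in> local_ring P"
  shows "local_cong P (prod f S) (prod g S)"
  using assms
  by (induction S rule: infinite_finite_induct) (auto intro!: local_cong_mult local_ring_prod)

text \<open>Exit from the localisation: with \<open>C = N / D\<close> the difference becomes
  \<open>P * N / D\<close>, whose numerator carries the required divisor.\<close>

lemma ratfun_congI:
  assumes "C \<in> local_ring P" "P \<noteq> 0" "A - B = to_fract P * C"
  shows "ratfun_cong A B (P :: 'a::field poly)"
proof -
  obtain N D where "C = to_fract N / to_fract D" "D \<noteq> 0" "invertible_mod P D"
    using assms by (auto simp: local_ring_def)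
  thus ?thesis using assms unfolding ratfun_cong_def
    by (intro exI[of _ "P * N"] exI[of _ D])
       (auto simp: Fract_conv_to_fract invertible_mod_imp_coprime)
qed

text \<open>The source of the squared modulus: an explicit factor \<open>P\<close> in front raises a
  congruence modulo \<open>P\<close> to one modulo \<open>P ^ 2\<close>. Denominators remain
  admissible by \<open>invertible_mod_square\<close>.\<close>

lemma local_cong_imp_ratfun_cong_mult:
  assumes "local_cong P U V" "C \<in> local_ring P" "P \<noteq> 0"
  shows "ratfun_cong (to_fract P * C * U) (to_fract P * C * V) ((P :: 'a::field poly) ^ 2)"
proof -
  obtain W where W: "W \<in> local_ring P" "U - V = to_fract P * W"
    using assms by (auto simp: local_cong_def)
  have sub: "local_ring P \<subseteq> local_ring (P ^ 2)"
    by (auto simp: local_ring_def intro: invertible_mod_square)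
  have eq: "to_fract P * C * U - to_fract P * C * V = to_fract P * C * (U - V)"
    by (simp add: algebra_simps)
  show ?thesis
  proof (rule ratfun_congI)
    show "C * W \<in> local_ring (P ^ 2)" using sub W assms by (auto intro!: local_ring_mult)
    show "to_fract P * C * U - to_fract P * C * V = to_fract (P ^ 2) * (C * W)"
      unfolding eq W(2) by (simp add: power2_eq_square)
  qed (use assms in auto)
qed

section \<open>Cyclotomic polynomials\<close>

text \<open>The factorisation over the complex numbers descends to the integers because
  \<open>map_poly of_int\<close> is injective there. Applying \<open>of_int\<close> again carries it
  to every field.\<close>

lemma cyclotomic_int_prod:
  assumes "n > 0"
  shows "(\<Prod>d | d dvd n. cyclotomic_poly d) = monom 1 n - 1"
proof -
  have "map_poly of_int (\<Prod>d | d dvd n. cyclotomic_poly d) =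
      (\<Prod>d | d dvd n. \<Prod>z\<in>primitive_roots_unity d. [:- z, 1:])"
    unfolding map_poly_of_int_prod
    by (intro prod.cong of_int_cyclotomic_poly) (use assms in \<open>auto intro!: Nat.gr0I\<close>)
  also have "\<dots> = monom 1 n - 1" using assms by (rule prod_primitive_roots_unity)
  also have "\<dots> = map_poly of_int (monom 1 n - 1)"
    by (rule poly_eqI) (simp add: coeff_map_poly)
  finally show ?thesis by (simp only: map_poly_of_int_inj)
qed

lemma cyclotomic_prod:
  assumes "n > 0"
  shows "(\<Prod>d | d dvd n. cyclotomic d) = (monom 1 n - 1 :: 'a::field poly)"
proof -
  have "(\<Prod>d | d dvd n. cyclotomic d :: 'a poly) = map_poly of_int (monom 1 n - 1)"
    unfolding cyclotomic_def
    by (simp only: cyclotomic_int_prod[OF assms, symmetric] map_poly_of_int_prod)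
  also have "\<dots> = monom 1 n - 1"
    by (rule poly_eqI) (simp add: coeff_map_poly)
  finally show ?thesis .
qed

lemma monom_minus_one_neq_0: "n > 0 \<Longrightarrow> monom 1 n - 1 \<noteq> (0 :: 'a::field poly)"
  by (auto simp: poly_eq_iff intro!: exI[of _ n])

lemma cyclotomic_dvd:
  assumes "n > 0"
  shows "cyclotomic n dvd (monom 1 n - 1 :: 'a::field poly)"
  unfolding cyclotomic_prod[OF assms, symmetric] using assms by (intro dvd_prodI) auto

lemma cyclotomic_nonzero: "n > 0 \<Longrightarrow> cyclotomic n \<noteq> (0 :: 'a::field poly)"
  using cyclotomic_dvd[of n, where 'a = 'a] monom_minus_one_neq_0[of n, where 'a = 'a] by auto

text \<open>Since \<open>n\<close> does not divide its proper divisor \<open>g\<close>, the index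
  \<open>n\<close> is new next to the divisors of \<open>g\<close>, and together they index a
  subproduct of the factorisation of \<open>monom 1 n - 1\<close>.\<close>

lemma cyclotomic_mult_dvd:
  assumes "n > 0" "g dvd n" "g \<noteq> n"
  shows "cyclotomic n * (monom 1 g - 1) dvd (monom 1 n - 1 :: 'a::field poly)"
proof -
  have g: "g > 0" using assms by (auto intro!: Nat.gr0I)
  have "finite {d. d dvd g}" using g by simp
  moreover have "n \<notin> {d. d dvd g}" using assms dvd_antisym by blast
  ultimately have "cyclotomic n * (monom 1 g - 1) =
      (\<Prod>d\<in>insert n {d. d dvd g}. cyclotomic d :: 'a poly)"
    by (simp add: cyclotomic_prod[OF g])
  also have "\<dots> dvd (\<Prod>d | d dvd n. cyclotomic d)"
    using assms by (intro prod_dvd_prod_subset) (auto intro: dvd_trans)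
  finally show ?thesis by (simp add: cyclotomic_prod assms)
qed

text \<open>Ring identity isolated for the next lemma, in which \<open>X\<close> is the variable,
  \<open>A'\<close> the derivative of \<open>A\<close>, \<open>D\<close> that of
  \<open>B * C\<close>, and \<open>N\<close> the constant \<open>of_nat n\<close>.\<close>

lemma bezout_rearrange:
  fixes N :: "'a::comm_ring_1"
  assumes "N = X * (A * D + A' * (B * C)) - N * (A * B * C)"
  shows "(X * A' * C) * B - N = A * (N * (B * C) - X * D)"
  using assms by (simp add: algebra_simps)

text \<open>Separability gives Bezout: if \<open>f = X\<^sup>n - 1\<close> factors as \<open>A * B * C\<close>, then
  \<open>X * f' - n * f = n\<close> exhibits \<open>n\<close> as a combination of \<open>A\<close> and \<open>B\<close>.\<close>

lemma invertible_mod_cyclotomic_divisor: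
  assumes "n > 0" "g dvd n" "g \<noteq> n"
  shows "invertible_mod (cyclotomic n) (monom 1 g - 1 :: 'a::field_char_0 poly)"
proof -
  let ?f = "monom 1 n - 1 :: 'a poly" and ?A = "cyclotomic n :: 'a poly"
    and ?B = "monom 1 g - 1 :: 'a poly" and ?X = "[:0, 1:] :: 'a poly"
  obtain C where C: "?f = ?A * ?B * C" using cyclotomic_mult_dvd[OF assms] by blast
  have 1: "?X * pderiv ?f - of_nat n * ?f = of_nat n"
  proof -
    have "?X * monom (of_nat n) (n - 1) = (monom (of_nat n) n :: 'a poly)"
      using assms by (cases n) (simp_all add: monom_Suc)
    thus ?thesis
      by (simp add: pderiv_diff pderiv_monom algebra_simps of_nat_poly smult_monom)
  qed
  have "pderiv ?f = ?A * pderiv (?B * C) + pderiv ?A * (?B * C)"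
    unfolding C by (simp only: mult.assoc pderiv_mult[of ?A]) (simp only: mult_ac)
  hence "of_nat n = ?X * (?A * pderiv (?B * C) + pderiv ?A * (?B * C)) - of_nat n * (?A * ?B * C)"
    using 1 C by simp
  hence "(?X * pderiv ?A * C) * ?B - of_nat n =
     ?A * (of_nat n * (?B * C) - ?X * pderiv (?B * C))"
    using bezout_rearrange by blast
  hence "?A dvd (?X * pderiv ?A * C) * ?B - of_nat n" by simp
  \<comment> \<open>Characteristic 0 makes the constant \<open>of_nat n\<close> a unit, so scaling
    normalises the Bezout relation to 1.\<close>
  hence "?A dvd [:inverse (of_nat n):] * ((?X * pderiv ?A * C) * ?B - of_nat n)"
    by (rule dvd_mult)
  also have "\<dots> = ([:inverse (of_nat n):] * (?X * pderiv ?A * C)) * ?B - 1"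
    using assms by (simp add: of_nat_poly right_diff_distrib smult_diff_right algebra_simps one_pCons)
  finally show ?thesis unfolding invertible_mod_def by blast
qed

lemma monom_minus_one_dvd: "monom 1 j - 1 dvd (monom 1 (j * k) - 1 :: 'a::field poly)"
proof -
  have "(monom 1 (j * k) - 1 :: 'a poly) = monom 1 j ^ k - 1" by (simp add: monom_power)
  thus ?thesis by (simp add: power_diff_1_eq)
qed

text \<open>Reduction to the proper divisor \<open>g = gcd j n\<close>. With
  \<open>j * a = n * b + g\<close> and X^n = 1 modulo \<open>cyclotomic n\<close>, X^g - 1 is
  congruent to X^(j a) - 1, a multiple of X^j - 1; so an inverse of the former yields one of the
  latter.\<close>

lemma invertible_mod_cyclotomic_monom_minus_one:
  assumes "n > 0" "\<not> n dvd j"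
  shows "invertible_mod (cyclotomic n) (monom 1 j - 1 :: 'a::field_char_0 poly)"
proof -
  define g where "g = gcd j n"
  have "j \<noteq> 0" using assms(2) by (metis dvd_0_right)
  then obtain a b where ab: "j * a = n * b + g" unfolding g_def using bezout_nat by blast
  obtain s where s: "monom 1 (j * a) - 1 = (monom 1 j - 1 :: 'a poly) * s"
    using monom_minus_one_dvd by blast
  have gn: "g dvd n" "g \<noteq> n" using assms(2) unfolding g_def by (simp, metis gcd_dvd1)
  obtain v where v: "cyclotomic n dvd v * (monom 1 g - 1) - (1 :: 'a poly)"
    using invertible_mod_cyclotomic_divisor[OF assms(1) gn, where 'a = 'a]
    by (auto simp: invertible_mod_def)
  have "(monom 1 (j * a) :: 'a poly) = monom 1 (n * b) * monom 1 g"
    unfolding ab by (simp add: mult_monom)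
  hence s': "(monom 1 j - 1) * s = monom 1 (n * b) * monom 1 g - 1"
    using s by simp
  have "(v * s) * (monom 1 j - 1) - 1 = v * ((monom 1 j - 1) * s) - 1"
    by (simp only: mult_ac)
  also have "\<dots> = (v * (monom 1 g - 1) - 1) + v * monom 1 g * (monom 1 (n * b) - 1)"
    unfolding s' by (simp add: algebra_simps)
  finally have "(v * s) * (monom 1 j - 1) - 1 =
      (v * (monom 1 g - 1) - 1) + v * monom 1 g * (monom 1 (n * b) - 1)" .
  moreover have "cyclotomic n dvd v * monom 1 g * (monom 1 (n * b) - 1)"
    using dvd_trans[OF cyclotomic_dvd[OF assms(1)] monom_minus_one_dvd] by (rule dvd_mult)
  ultimately show ?thesis unfolding invertible_mod_def using v by (metis dvd_add)
qed

text \<open>For y = c X^j the geometric sum times 1 - y is 1 - y^n, which is congruent to the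
  nonzero constant 1 - c^n. Hence no divisibility condition on \<open>j\<close> appears.\<close>

lemma invertible_mod_cyclotomic_one_minus_const_monom:
  fixes c :: "'a::field"
  assumes "n > 0" "c ^ n \<noteq> 1"
  shows "invertible_mod (cyclotomic n) (1 - [:c:] * monom 1 j)"
proof -
  define y where "y = [:c:] * monom 1 j"
  define e where "e = inverse (1 - c ^ n)"
  have e: "e - e * c ^ n = 1" using assms by (simp add: e_def field_simps)
  have "1 - y ^ n = (1 - y) * (\<Sum>i<n. y ^ i)"
    using power_diff_1_eq[of y n] by (simp add: algebra_simps)
  hence "[:e:] * (\<Sum>i<n. y ^ i) * (1 - y) - 1 = [:e:] * (1 - y ^ n) - 1"
    by (simp only: mult_ac)
  also have "y ^ n = [:c ^ n:] * monom 1 (n * j)"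
    by (simp add: y_def power_mult_distrib monom_power poly_const_pow mult.commute smult_power)
  also have "[:e:] * (1 - [:c ^ n:] * monom 1 (n * j)) - 1 =
      - [:e * c ^ n:] * (monom 1 (n * j) - 1)"
  proof -
    have "u * (1 - w * z) - 1 = - (u * w) * (z - 1)" if "u - u * w = 1" for u w z :: "'a poly"
      using that by (simp add: algebra_simps)
    moreover have "[:e:] - [:e:] * [:c ^ n:] = 1" using e by (simp add: one_pCons mult.commute)
    moreover have "[:e * c ^ n:] = [:e:] * [:c ^ n:]" by simp
    ultimately show ?thesis by metis
  qed
  finally have "[:e:] * (\<Sum>i<n. y ^ i) * (1 - y) - 1 = - [:e * c ^ n:] * (monom 1 (n * j) - 1)" .
  moreover have "cyclotomic n dvd - [:e * c ^ n:] * (monom 1 (n * j) - 1)"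
    using dvd_trans[OF cyclotomic_dvd[OF assms(1)] monom_minus_one_dvd] by (rule dvd_mult)
  ultimately show ?thesis unfolding invertible_mod_def y_def by metis
qed

text \<open>The conjunct \<open>A \<noteq> 0\<close> excludes zero, which would pass the other two
  tests because \<open>inverse 0 = 0\<close>.\<close>

definition local_unit :: "'a::idom \<Rightarrow> 'a fract \<Rightarrow> bool" where
  "local_unit P A \<longleftrightarrow> A \<noteq> 0 \<and> A \<in> local_ring P \<and> inverse A \<in> local_ring P"

lemma local_unit_to_fract: "invertible_mod P D \<Longrightarrow> D \<noteq> 0 \<Longrightarrow> local_unit P (to_fract D)"
  by (simp add: local_unit_def local_ring_inverse)

lemma local_unit_mult: "local_unit P A \<Longrightarrow> local_unit P B \<Longrightarrow> local_unit P (A * B)"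
  by (simp add: local_unit_def local_ring_mult)

lemma local_unit_uminus: "local_unit P A \<Longrightarrow> local_unit P (- A)"
  by (simp add: local_unit_def local_ring_uminus)

lemma local_unit_inverse: "local_unit P A \<Longrightarrow> local_unit P (inverse A)"
  by (simp add: local_unit_def)

lemma local_unit_one [simp]: "local_unit P 1"
  by (simp add: local_unit_def)

lemma local_unit_power: "local_unit P A \<Longrightarrow> local_unit P (A ^ k)"
  by (induction k) (auto intro: local_unit_mult)

lemma local_unit_powi: "local_unit P A \<Longrightarrow> local_unit P (A powi k)"
  by (auto simp: power_int_def local_unit_power local_unit_inverse)

lemma local_unit_prod: "(\<And>i. i \<in> S \<Longrightarrow> local_unit P (f i)) \<Longrightarrow> local_unit P (prod f S)"
  by (induction S rule: infinite_finite_induct) (auto intro: local_unit_mult)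

lemma local_unit_imp_in: "local_unit P A \<Longrightarrow> A \<in> local_ring P"
  by (simp add: local_unit_def)

lemma local_cong_divide_units:
  assumes "local_cong P A A'" "local_cong P B B'" "A' \<in> local_ring P"
    and "local_unit P B" "local_unit P B'"
  shows "local_cong P (A / B) (A' / B')"
  using assms by (auto simp: local_unit_def intro: local_cong_divide)

section \<open>Powers of q modulo the cyclotomic polynomial\<close>

lemma ratfun_q_power: "ratfun_q ^ k = to_fract (monom 1 k)"
  by (induction k) (simp_all add: ratfun_q_def monom_Suc flip: to_fract_def to_fract_mult)

lemma ratfun_q_nonzero [simp]: "ratfun_q \<noteq> 0"
  by (simp add: ratfun_q_def flip: to_fract_def)

lemma local_unit_ratfun_q:
  assumes "n > 0"
  shows "local_unit (cyclotomic n) (ratfun_q :: 'a::field poly fract)"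
proof -
  \<comment> \<open>X^(n-1) inverts X, because X^n = 1 modulo \<open>cyclotomic n\<close>.\<close>
  have "monom 1 (n - 1) * monom 1 1 = (monom 1 n :: 'a poly)"
    using assms by (simp add: mult_monom)
  hence "invertible_mod (cyclotomic n) (monom 1 1 :: 'a poly)"
    unfolding invertible_mod_def using cyclotomic_dvd[OF assms, where 'a = 'a] by metis
  hence "local_unit (cyclotomic n) (to_fract (monom 1 1 :: 'a poly))"
    by (rule local_unit_to_fract) (simp add: monom_eq_0_iff)
  thus ?thesis by (simp flip: ratfun_q_power)
qed

lemma local_unit_one_minus_q_power:
  assumes "n > 0" "\<not> n dvd j"
  shows "local_unit (cyclotomic n) (1 - ratfun_q ^ j :: 'a::field_char_0 poly fract)"
proof -
  have "j > 0" using assms by (auto intro!: Nat.gr0I)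
  hence "local_unit (cyclotomic n) (to_fract (monom 1 j - 1 :: 'a poly))"
    using assms
    by (intro local_unit_to_fract invertible_mod_cyclotomic_monom_minus_one monom_minus_one_neq_0)
  hence "local_unit (cyclotomic n) (- (ratfun_q ^ j - 1) :: 'a poly fract)"
    by (intro local_unit_uminus) (simp add: ratfun_q_power)
  thus ?thesis by simp
qed

lemma local_unit_one_minus_const_q_power:
  fixes c :: "'a::field"
  assumes "n > 0" "c ^ n \<noteq> 1"
  shows "local_unit (cyclotomic n) (1 - to_fract [:c:] * ratfun_q ^ j)"
proof -
  have "1 - [:c:] * monom 1 j \<noteq> 0"
  proof
    assume "1 - [:c:] * monom 1 j = 0"
    \<comment> \<open>Evaluation at 1 makes the exponent \<open>j\<close> disappear.\<close>
    hence "poly (1 - [:c:] * monom 1 j) 1 = 0" by simp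
    hence "c = 1" by (simp add: poly_monom)
    with assms show False by simp
  qed
  hence "local_unit (cyclotomic n) (to_fract (1 - [:c:] * monom 1 j))"
    using assms by (intro local_unit_to_fract invertible_mod_cyclotomic_one_minus_const_monom)
  thus ?thesis by (simp add: ratfun_q_power del: mult_pCons_left)
qed

lemma one_minus_q_power_cyclotomic:
  assumes "n > 0"
  obtains C where "C \<in> local_ring (cyclotomic n)"
    "1 - ratfun_q ^ n = to_fract (cyclotomic n :: 'a::field poly) * C"
proof -
  obtain r where r: "monom 1 n - 1 = (cyclotomic n :: 'a poly) * r"
    using cyclotomic_dvd[OF assms] by blast
  have "1 - ratfun_q ^ n = - to_fract (monom 1 n - 1 :: 'a poly)" by (simp add: ratfun_q_power)
  also have "\<dots> = to_fract (cyclotomic n) * to_fract (- r)" by (simp add: r)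
  finally show ?thesis using that by blast
qed

lemma local_cong_q_power_n:
  assumes "n > 0"
  shows "local_cong (cyclotomic n) (ratfun_q ^ n :: 'a::field poly fract) 1"
  using one_minus_q_power_cyclotomic[OF assms, where 'a = 'a]
  unfolding local_cong_def by (metis local_cong_def local_cong_sym)

lemma local_cong_power_one:
  assumes "local_cong P A 1" "A \<in> local_ring P"
  shows "local_cong P (A ^ k) 1"
proof (induction k)
  case (Suc k)
  have "local_cong P (A * A ^ k) (1 * 1)"
    using assms Suc by (intro local_cong_mult) (auto intro: local_ring_power)
  thus ?case by simp
qed simp

text \<open>Exponents of q, negative ones included, matter only modulo \<open>n\<close>. Natural
  multiples of \<open>n\<close> are added first; a negative multiple is handled by exchanging
  \<open>a\<close> and \<open>b\<close>.\<close>

lemma local_cong_q_powi: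
  assumes "n > 0" "int n dvd a - b"
  shows "local_cong (cyclotomic n) (ratfun_q powi a :: 'a::field poly fract) (ratfun_q powi b)"
proof -
  let ?q = "ratfun_q :: 'a poly fract" and ?P = "cyclotomic n :: 'a poly"
  have *: "local_cong ?P (?q powi (b + int n * int k)) (?q powi b)" for b k
  proof -
    have "local_cong ?P ((?q ^ n) ^ k) 1"
      using assms by (intro local_cong_power_one local_cong_q_power_n local_ring_power
          local_unit_imp_in local_unit_ratfun_q)
    hence "local_cong ?P (?q powi b * (?q ^ n) ^ k) (?q powi b * 1)"
      using assms by (intro local_cong_mult local_ring_power local_unit_imp_in
          local_unit_ratfun_q local_unit_powi) simp_all
    moreover have "?q powi (b + int n * int k) = ?q powi b * (?q ^ n) ^ k"
      by (simp add: power_int_add power_mult flip: of_nat_mult)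
    ultimately show ?thesis by simp
  qed
  obtain k where k: "a - b = int n * k" using assms by blast
  show ?thesis
  proof (cases "k \<ge> 0")
    case True
    thus ?thesis using *[of b "nat k"] k by (simp add: algebra_simps)
  next
    case False
    hence "a + int n * int (nat (-k)) = b" using k by (simp add: algebra_simps)
    thus ?thesis using *[of a "nat (-k)"] by (simp add: local_cong_sym)
  qed
qed

section \<open>Shifted factorials\<close>

lemma qpoch_Suc: "qpoch a p (Suc k) = qpoch a p k * (1 - a * p ^ k)"
  by (simp add: qpoch_def)

lemma qpoch_Suc_shift: "qpoch a p (Suc k) = (1 - a) * qpoch (a * p) p k"
  unfolding qpoch_def by (subst prod.lessThan_Suc_shift) (simp add: mult.assoc)

lemma qpoch_0 [simp]: "qpoch a p 0 = 1" "qpoch 0 p k = 1"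
  by (simp_all add: qpoch_def)

lemma local_unit_qpoch:
  "(\<And>i. i < k \<Longrightarrow> local_unit P (1 - a * p ^ i)) \<Longrightarrow> local_unit P (qpoch a p k)"
  unfolding qpoch_def by (rule local_unit_prod) simp

lemma local_ring_qpoch:
  "a \<in> local_ring P \<Longrightarrow> p \<in> local_ring P \<Longrightarrow> qpoch a p k \<in> local_ring P"
  unfolding qpoch_def by (intro local_ring_intros)

text \<open>An indefinite summation, valid for every upper limit \<open>m\<close> without any
  terminating condition on \<open>a\<close> or \<open>b\<close>, hence provable by induction on
  \<open>m\<close>. Taking \<open>b = 0\<close> removes the second pair of factorials.\<close>

lemma qpoch_sum:
  fixes a b p :: "'a::field"
  assumes "\<And>i. i < m \<Longrightarrow> 1 - p * p ^ i \<noteq> 0" "\<And>i. i < m \<Longrightarrow> 1 - a * b * p * p ^ i \<noteq> 0"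
  shows "(\<Sum>k = 0..m. (qpoch a p k * qpoch b p k) / (qpoch p p k * qpoch (a * b * p) p k) * p ^ k) =
    (qpoch (a * p) p m * qpoch (b * p) p m) / (qpoch p p m * qpoch (a * b * p) p m)"
  using assms
proof (induction m)
  case (Suc m)
  define A B C D where "A = qpoch (a * p) p m" and "B = qpoch (b * p) p m"
    and "C = qpoch p p m" and "D = qpoch (a * b * p) p m"
  define t where "t = p * p ^ m"
  define u v where "u = 1 - t" and "v = 1 - a * b * t"
  have nz: "u \<noteq> 0" "v \<noteq> 0"
    using Suc.prems(1)[of m] Suc.prems(2)[of m] by (simp_all add: t_def u_def v_def mult.assoc)
  \<comment> \<open>Splitting off the first factor of the numerator factorials but the last factor
    of the denominator ones lets the new term share \<open>(A * B) / (C * D)\<close> with the old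
    sum.\<close>
  have "(\<Sum>k = 0..Suc m. (qpoch a p k * qpoch b p k) / (qpoch p p k * qpoch (a * b * p) p k) * p ^ k)
      = (A * B) / (C * D) + ((1 - a) * A * ((1 - b) * B)) / ((C * u) * (D * v)) * t"
    using Suc.IH Suc.prems
    by (simp add: qpoch_Suc_shift[of a] qpoch_Suc_shift[of b] qpoch_Suc[of p] qpoch_Suc[of "a * b * p"]
        t_def u_def v_def A_def B_def C_def D_def)
  also have "\<dots> = (A * B) / (C * D) * ((u * v + (1 - a) * (1 - b) * t) / (u * v))"
    using nz by (simp add: add_divide_distrib distrib_left mult_ac)
  \<comment> \<open>The identity behind the telescoping: the numerator factorises into exactly the
    two factors that extend \<open>A\<close> and \<open>B\<close>.\<close>
  also have "u * v + (1 - a) * (1 - b) * t = (1 - a * t) * (1 - b * t)"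
    by (simp add: u_def v_def algebra_simps)
  also have "(A * B) / (C * D) * ((1 - a * t) * (1 - b * t) / (u * v)) =
     (A * (1 - a * t)) * (B * (1 - b * t)) / ((C * u) * (D * v))"
    by (simp add: mult_ac)
  finally show ?case
    by (simp add: qpoch_Suc t_def u_def v_def A_def B_def C_def D_def mult.assoc)
qed simp

text \<open>The hypothesis on \<open>b\<close> says that the last factor is 1 - y q^n. Read
  backwards, the factors are 1 - y p^(-i) q^n; replacing q^n by 1 and extracting -y p^(-i) leaves 1
  - y^(-1) p^i.\<close>

lemma qpoch_reverse_cong:
  fixes y b :: "'a::field poly fract" and d n m :: nat
  defines "p \<equiv> ratfun_q ^ d"
  assumes n: "n > 0" and b: "b * p ^ m = y * ratfun_q ^ n * p"
    and y: "y \<noteq> 0" "y \<in> local_ring (cyclotomic n)"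
  shows "local_cong (cyclotomic n) (qpoch b p m)
           ((- y) ^ m * inverse (p ^ (\<Sum>i<m. i)) * qpoch (inverse y) p m)"
proof -
  let ?P = "cyclotomic n :: 'a poly"
  have p0: "p \<noteq> 0" by (simp add: p_def)
  have pu: "local_unit ?P p" unfolding p_def using n
    by (intro local_unit_power local_unit_ratfun_q)
  have q: "ratfun_q \<in> local_ring ?P" using n by (intro local_unit_imp_in local_unit_ratfun_q)
  have ip: "inverse (p ^ i) \<in> local_ring ?P" for i
    using pu by (intro local_unit_imp_in local_unit_inverse local_unit_power)
  have eq: "b * p ^ (m - Suc i) = y * inverse (p ^ i) * ratfun_q ^ n" if "i < m" for i
  proof -
    have "p ^ m = p ^ (m - Suc i) * p ^ i * p"
      using that by (simp flip: power_add power_Suc2)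
    with b have "(b * p ^ (m - Suc i) * p ^ i) * p = (y * ratfun_q ^ n) * p"
      by (simp add: mult_ac)
    hence "b * p ^ (m - Suc i) * p ^ i = y * ratfun_q ^ n" using p0 by simp
    thus ?thesis using p0 by (simp add: field_simps)
  qed
  have "qpoch b p m = (\<Prod>i<m. 1 - b * p ^ (m - Suc i))"
    unfolding qpoch_def by (rule prod.nat_diff_reindex[symmetric])
  also have "\<dots> = (\<Prod>i<m. 1 - y * inverse (p ^ i) * ratfun_q ^ n)"
    by (intro prod.cong) (simp_all add: eq)
  also have "local_cong ?P \<dots> (\<Prod>i<m. 1 - y * inverse (p ^ i) * 1)"
    by (intro local_cong_prod local_cong_diff_left local_cong_mult local_cong_q_power_n
        local_ring_intros local_cong_refl n y q ip)
  also have "(\<Prod>i<m. 1 - y * inverse (p ^ i) * 1) =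
      (\<Prod>i<m. (- y) * inverse (p ^ i) * (1 - inverse y * p ^ i))"
    using y p0 by (intro prod.cong) (simp_all add: field_simps)
  also have "\<dots> = (- y) ^ m * inverse (p ^ (\<Sum>i<m. i)) * qpoch (inverse y) p m"
    by (simp only: prod.distrib prod_constant card_lessThan power_sum prod_inversef[symmetric] qpoch_def o_def)
  finally show ?thesis .
qed

section \<open>Shifted factorials and their quotients modulo the cyclotomic polynomial\<close>

lemma not_dvd_mult_of_less:
  fixes n d j :: nat
  assumes "coprime n d" "0 < j" "j < n"
  shows "\<not> n dvd d * j"
  using assms by (auto simp: coprime_dvd_mult_right_iff dest: dvd_imp_le)

lemma local_unit_qpoch_q:
  assumes "n > 0" "\<And>j. 0 < j \<Longrightarrow> j \<le> m \<Longrightarrow> \<not> n dvd d * j"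
  shows "local_unit (cyclotomic n)
    (qpoch (ratfun_q ^ d) (ratfun_q ^ d) m :: 'a::field_char_0 poly fract)"
proof (rule local_unit_qpoch)
  fix i assume "i < m"
  hence "\<not> n dvd d * Suc i" using assms(2)[of "Suc i"] by simp
  hence "local_unit (cyclotomic n) (1 - ratfun_q ^ (d * Suc i) :: 'a poly fract)"
    using assms(1) by (intro local_unit_one_minus_q_power)
  thus "local_unit (cyclotomic n) (1 - ratfun_q ^ d * (ratfun_q ^ d) ^ i :: 'a poly fract)"
    by (simp add: power_mult power_add)
qed

text \<open>Every factor has the form 1 - c q^(l + d i), a unit whatever the exponent, since
  \<open>c\<close> is not an n-th root of unity.\<close>

lemma local_unit_qpoch_const:
  fixes c :: "'a::field"
  assumes "n > 0" "c ^ n \<noteq> 1"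
  shows "local_unit (cyclotomic n) (qpoch (ratfun_q ^ l * to_fract [:c:]) (ratfun_q ^ d) m)"
proof (rule local_unit_qpoch)
  fix i
  show "local_unit (cyclotomic n) (1 - ratfun_q ^ l * to_fract [:c:] * (ratfun_q ^ d) ^ i)"
    using local_unit_one_minus_const_q_power[OF assms, of "l + d * i"]
    by (simp add: power_add power_mult mult_ac)
qed

text \<open>Both sides of the fraction are compared with \<open>qpoch p p (m - 1)\<close>, which
  then cancels. The numerator has length \<open>m - 1\<close> because its factor 1 - q^n has already
  been removed.\<close>

lemma cyclotomic_quotient_cong:
  fixes d n m :: nat
  defines "q \<equiv> ratfun_q :: 'a::field_char_0 poly fract"
  assumes d2: "d \<ge> 2" and n: "n > 1" and m: "n + 1 = d * m"
  shows "local_cong (cyclotomic n)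
    (qpoch (q ^ (d - 1)) (q ^ d) (m - 1) / qpoch (q ^ d) (q ^ d) m)
    ((- 1) ^ (m + 1) * inverse ((q ^ d) ^ (\<Sum>i<m. i)) / (1 - q))"
proof -
  let ?P = "cyclotomic n :: 'a poly"
  define p where "p = q ^ d"
  obtain M where M: "m = Suc M" using m by (cases m) auto
  have d: "d > 0" using m by (auto intro!: Nat.gr0I)
  have nM: "n = d - 1 + d * M" using m d by (simp add: M)
  have qu: "local_unit ?P q" unfolding q_def using n by (intro local_unit_ratfun_q) simp
  have pu: "local_unit ?P p" unfolding p_def using qu by (rule local_unit_power)
  have p0: "p \<noteq> 0" using pu by (simp add: local_unit_def)
  have q: "q \<in> local_ring ?P" and ip: "inverse p \<in> local_ring ?P"
    using qu pu by (simp_all add: local_unit_def)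
  have "coprime n d"
  proof (rule coprimeI)
    fix c assume "c dvd n" "c dvd d"
    moreover from this have "c dvd n + 1" unfolding m by simp
    ultimately show "is_unit c" by (metis dvd_add_right_iff)
  qed
  have ndvd: "\<not> n dvd d * j" if "0 < j" "j \<le> M" for j
  proof (rule not_dvd_mult_of_less)
    \<comment> \<open>With d at least 2, \<open>n = d - 1 + d * M\<close> exceeds \<open>M\<close>,
      hence every \<open>j\<close> in question.\<close>
    have "1 * M \<le> d * M" using d2 by (intro mult_right_mono) auto
    thus "j < n" using that nM d2 by linarith
  qed (use that \<open>coprime n d\<close> in auto)
  have QM: "local_unit ?P (qpoch p p M)"
    unfolding p_def q_def using n by (intro local_unit_qpoch_q ndvd) auto
  \<comment> \<open>This is the reversal hypothesis with \<open>y = inverse p\<close>; reversing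
    therefore produces \<open>qpoch p p M\<close>.\<close>
  have b: "q ^ (d - 1) * p ^ M = inverse p * q ^ n * p"
    using p0 by (simp add: nM p_def power_add power_mult)
  have "local_cong ?P (qpoch (q ^ (d - 1)) p M)
      ((- inverse p) ^ M * inverse (p ^ (\<Sum>i<M. i)) * qpoch (inverse (inverse p)) p M)"
    unfolding p_def q_def
    by (rule qpoch_reverse_cong) (use n b ip p0 in \<open>auto simp: p_def q_def\<close>)
  hence num: "local_cong ?P (qpoch (q ^ (d - 1)) p M)
      ((- inverse p) ^ M * inverse (p ^ (\<Sum>i<M. i)) * qpoch p p M)" by simp
  \<comment> \<open>The last factor of the denominator is 1 - q^(n+1), congruent to 1 - q.\<close>
  have "p * p ^ M = q ^ n * q"
    using m unfolding M p_def by (metis power_Suc power_mult Suc_eq_plus1 mult.commute)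
  hence "qpoch p p m = qpoch p p M * (1 - q ^ n * q)" by (simp add: M qpoch_Suc)
  moreover have "local_cong ?P (q ^ n * q) (1 * q)"
    using n by (intro local_cong_mult) (auto simp: q_def local_cong_q_power_n q[unfolded q_def])
  ultimately have den: "local_cong ?P (qpoch p p m) (qpoch p p M * (1 - q))"
    using local_unit_imp_in[OF QM] q
    by (auto intro!: local_cong_mult local_cong_diff_left local_ring_intros)
  have u1: "local_unit ?P (1 - q)"
    using local_unit_one_minus_q_power[of n 1, where 'a = 'a] n by (simp add: q_def)
  have "\<not> n dvd n + 1" using n by (metis dvd_add_right_iff dvd_refl nat_dvd_1_iff_1 less_irrefl)
  hence "local_unit ?P (1 - q ^ (n + 1))"
    unfolding q_def using n by (intro local_unit_one_minus_q_power) auto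
  hence Qm: "local_unit ?P (qpoch p p m)"
    using QM \<open>qpoch p p m = _\<close> by (simp add: local_unit_mult mult.commute)
  have "local_cong ?P (qpoch (q ^ (d - 1)) p M / qpoch p p m)
     (((- inverse p) ^ M * inverse (p ^ (\<Sum>i<M. i)) * qpoch p p M) / (qpoch p p M * (1 - q)))"
    by (intro local_cong_divide_units num den Qm local_unit_mult QM u1 local_unit_imp_in
        local_unit_power local_unit_uminus local_unit_inverse pu)
  \<comment> \<open>The power p^(-M) supplies the missing term \<open>i = M\<close> of the exponent
    sum, and M and m + 1 have equal parity.\<close>
  also have "((- inverse p) ^ M * inverse (p ^ (\<Sum>i<M. i)) * qpoch p p M) / (qpoch p p M * (1 - q))
     = (- 1) ^ (m + 1) * inverse (p ^ (\<Sum>i<m. i)) / (1 - q)"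
    using QM unfolding local_unit_def
    by (simp add: M power_add power_minus[of "inverse p"] power_inverse mult_ac)
  finally show ?thesis by (simp add: M p_def)
qed

lemma inverse_to_fract_const:
  fixes c :: "'a::field"
  assumes "c \<noteq> 0"
  shows "inverse (to_fract [:c:]) = to_fract [:inverse c:]"
proof (rule inverse_unique)
  have "to_fract [:c:] * to_fract [:inverse c:] = to_fract ([:c:] * [:inverse c:])"
    by (rule to_fract_mult[symmetric])
  also have "[:c:] * [:inverse c:] = 1" using assms by (simp add: one_pCons)
  finally show "to_fract [:c:] * to_fract [:inverse c:] = 1" by simp
qed

text \<open>Both factorials are reversed, the numerator with \<open>y = q * x\<close> and the
  denominator with \<open>y = x\<close>. The powers of \<open>p\<close> cancel, and of the
  prefactors only (-q x)^m / (-x)^m = q^m survives.\<close>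

lemma const_quotient_cong:
  fixes d n m :: nat and c :: "'a::field"
  defines "q \<equiv> ratfun_q" and "x \<equiv> to_fract [:c:]"
  assumes n: "n > 0" and m: "n + 1 = d * m" and c: "c \<noteq> 0" "c ^ n \<noteq> 1"
  shows "local_cong (cyclotomic n)
    (qpoch (x * q ^ d) (q ^ d) m / qpoch (q ^ (d - 1) * x) (q ^ d) m)
    (q ^ m * (qpoch (inverse (q * x)) (q ^ d) m / qpoch (inverse x) (q ^ d) m))"
proof -
  let ?P = "cyclotomic n :: 'a poly"
  define p where "p = q ^ d"
  define S where "S = inverse (p ^ (\<Sum>i<m. i))"
  have d: "d > 0" using m by (auto intro!: Nat.gr0I)
  have qu: "local_unit ?P q" unfolding q_def using n by (rule local_unit_ratfun_q)
  have q0: "q \<noteq> 0" by (simp add: q_def)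
  have pu: "local_unit ?P p" unfolding p_def using qu by (rule local_unit_power)
  have x0: "x \<noteq> 0" using c by (simp add: x_def)
  have ix: "inverse x = to_fract [:inverse c:]"
    unfolding x_def using c(1) by (rule inverse_to_fract_const)
  have xu: "local_unit ?P x" unfolding local_unit_def ix using x0 by (auto simp: x_def)
  have Su: "local_unit ?P S" unfolding S_def
    by (intro local_unit_inverse local_unit_power pu)
  have pm: "p ^ m = q ^ n * q"
    using m unfolding p_def by (metis Suc_eq_plus1 power_Suc2 power_mult)
  have qd: "q ^ (d - 1) * q = p" unfolding p_def using d by (cases d) simp_all
  have num: "local_cong ?P (qpoch (x * p) p m) ((- (q * x)) ^ m * S * qpoch (inverse (q * x)) p m)"
    unfolding p_def q_def S_def
    by (rule qpoch_reverse_cong)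
       (use n x0 q0 qu xu pm in
         \<open>auto simp: p_def q_def mult_ac intro!: local_unit_mult local_unit_imp_in\<close>)
  have "q ^ (d - 1) * x * p ^ m = x * q ^ n * p"
    unfolding pm by (simp add: mult_ac flip: qd)
  hence den: "local_cong ?P (qpoch (q ^ (d - 1) * x) p m) ((- x) ^ m * S * qpoch (inverse x) p m)"
    unfolding p_def q_def S_def
    by (intro qpoch_reverse_cong)
       (use n x0 xu in \<open>auto simp: p_def q_def mult_ac intro!: local_unit_imp_in\<close>)
  have Q1: "local_unit ?P (qpoch (q ^ (d - 1) * x) p m)"
    unfolding q_def x_def p_def by (rule local_unit_qpoch_const) fact+
  \<comment> \<open>The reversed denominator involves 1/x, so the unit criterion is needed for
    \<open>inverse c\<close> too, with \<open>l = 0\<close>.\<close>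
  have "inverse c ^ n \<noteq> 1" using c by (simp add: power_inverse)
  from local_unit_qpoch_const[OF n this, of 0 d m]
  have Q2: "local_unit ?P (qpoch (inverse x) p m)" by (simp add: ix p_def q_def)
  have "qpoch (inverse (q * x)) p m \<in> local_ring ?P"
    by (intro local_ring_qpoch local_unit_imp_in local_unit_inverse local_unit_mult qu xu pu)
  hence "(- (q * x)) ^ m * S * qpoch (inverse (q * x)) p m \<in> local_ring ?P"
    by (intro local_ring_mult local_ring_power local_ring_uminus local_unit_imp_in[OF qu]
        local_unit_imp_in[OF xu] local_unit_imp_in[OF Su])
  hence "local_cong ?P (qpoch (x * p) p m / qpoch (q ^ (d - 1) * x) p m)
    (((- (q * x)) ^ m * S * qpoch (inverse (q * x)) p m) / ((- x) ^ m * S * qpoch (inverse x) p m))"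
    by (intro local_cong_divide_units num den Q1 Q2 local_unit_mult local_unit_power
        local_unit_uminus xu Su)
  also have "((- (q * x)) ^ m * S * qpoch (inverse (q * x)) p m) / ((- x) ^ m * S * qpoch (inverse x) p m)
     = q ^ m * (qpoch (inverse (q * x)) p m / qpoch (inverse x) p m)"
  proof -
    have "(- (q * x)) ^ m = q ^ m * (- x) ^ m"
      by (metis mult_minus_right power_mult_distrib)
    thus ?thesis using Su x0 by (simp add: local_unit_def)
  qed
  finally show ?thesis by (simp add: p_def)
qed

section \<open>Evaluation of the sums and reduction to their cofactors\<close>

lemma sum_lessThan_id: "2 * (\<Sum>i<m. int i) = int m * (int m - 1)"
  by (induction m) (simp_all add: algebra_simps)

lemma qint_split: "qint q n = (1 - q ^ n) * inverse (1 - q)"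
  by (simp add: qint_def divide_inverse)

lemma sum_closed_form:
  fixes d n m :: nat and c :: "'a::field_char_0"
  defines "q \<equiv> ratfun_q" and "x \<equiv> to_fract [:c:]"
  assumes n: "n > 1" and m: "n + 1 = d * m" and c: "c ^ n \<noteq> 1"
  shows "(\<Sum>k = 0..m. (qpoch (inverse q) (q ^ d) k * qpoch x (q ^ d) k)
             / (qpoch (q ^ d) (q ^ d) k * qpoch (q ^ (d - 1) * x) (q ^ d) k) * q ^ (d * k)) =
     (1 - q ^ n) * (qpoch (q ^ (d - 1)) (q ^ d) (m - 1) / qpoch (q ^ d) (q ^ d) m *
       (qpoch (x * q ^ d) (q ^ d) m / qpoch (q ^ (d - 1) * x) (q ^ d) m))"
proof -
  let ?P = "cyclotomic n :: 'a poly"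
  define p where "p = q ^ d"
  obtain M where M: "m = Suc M" using m by (cases m) auto
  have d: "d > 0" using m by (auto intro!: Nat.gr0I)
  have q0: "q \<noteq> 0" by (simp add: q_def)
  have qd: "q ^ (d - 1) = inverse q * p" unfolding p_def using d q0 by (cases d) simp_all
  have "1 - p * p ^ i \<noteq> 0" for i
  proof -
    have "monom 1 (d * Suc i) - 1 \<noteq> (0 :: 'a poly)" using d by (intro monom_minus_one_neq_0) simp
    hence "to_fract (monom 1 (d * Suc i) - 1 :: 'a poly) \<noteq> 0" by (subst to_fract_eq_0_iff)
    hence "q ^ (d * Suc i) - 1 \<noteq> 0" by (simp add: q_def ratfun_q_power)
    thus ?thesis by (simp add: p_def power_mult power_add)
  qed
  moreover have "1 - inverse q * x * p * p ^ i \<noteq> 0" for i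
  proof -
    have "local_unit ?P (1 - x * q ^ (d - 1 + d * i))"
      unfolding x_def q_def using n c by (intro local_unit_one_minus_const_q_power) auto
    moreover have "x * q ^ (d - 1 + d * i) = inverse q * x * p * p ^ i"
      unfolding power_add power_mult qd p_def[symmetric] by (simp only: mult_ac)
    ultimately show ?thesis unfolding local_unit_def by metis
  qed
  ultimately have closed: "(\<Sum>k = 0..m. (qpoch (inverse q) p k * qpoch x p k)
       / (qpoch p p k * qpoch (inverse q * x * p) p k) * p ^ k) =
    (qpoch (inverse q * p) p m * qpoch (x * p) p m) / (qpoch p p m * qpoch (inverse q * x * p) p m)"
    by (intro qpoch_sum)
  have eq: "inverse q * x * p = q ^ (d - 1) * x" unfolding qd by (simp only: mult_ac)
  have last: "qpoch (q ^ (d - 1)) p m = qpoch (q ^ (d - 1)) p (m - 1) * (1 - q ^ n)"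
  proof -
    have "n = d - 1 + d * M" using m d by (simp add: M)
    hence "q ^ (d - 1) * p ^ M = q ^ n" by (simp only: p_def power_mult power_add)
    thus ?thesis by (simp add: M qpoch_Suc)
  qed
  show ?thesis
    unfolding power_mult p_def[symmetric] closed[unfolded eq, folded qd, unfolded last]
    by (simp only: divide_inverse inverse_mult_distrib mult_ac)
qed

text \<open>\<open>qpoch_sum\<close> with a = q: the last factor of (q p; p)_m is 1 - q^(1 + d m) =
  1 - q^n, and everything else lies in the local ring. The theorem uses it with \<open>2 * d\<close>
  in place of \<open>d\<close>.\<close>

lemma sum_vanishes:
  fixes d n m :: nat and c :: "'a::field_char_0"
  defines "q \<equiv> ratfun_q" and "x \<equiv> to_fract [:c:]"
  assumes n: "n > 1" and m: "n = d * m + 1" and c: "c ^ n \<noteq> 1"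
  shows "ratfun_cong (\<Sum>k = 0..m. (qpoch q (q ^ d) k * qpoch x (q ^ d) k)
             / (qpoch (q ^ d) (q ^ d) k * qpoch (q ^ (d + 1) * x) (q ^ d) k) * q ^ (d * k))
           0 (cyclotomic n)"
proof -
  let ?P = "cyclotomic n :: 'a poly"
  define p where "p = q ^ d"
  have d: "d > 0" and m0: "m > 0" using m n by (auto intro!: Nat.gr0I)
  have n0: "n > 0" using n by simp
  obtain M where M: "m = Suc M" using m0 by (cases m) auto
  have qu: "local_unit ?P q" unfolding q_def using n0 by (rule local_unit_ratfun_q)
  have pu: "local_unit ?P p" unfolding p_def using qu by (rule local_unit_power)
  \<comment> \<open>Immediate from \<open>n = d * m + 1\<close>; as also m < n, no
    \<open>d * j\<close> with j from 1 to m is a multiple of \<open>n\<close>.\<close>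
  have "coprime n d"
    unfolding m using coprime_1_left by (metis coprime_iff_gcd_eq_1 gcd_add_mult gcd.commute add.commute mult.commute)
  hence ndvd: "\<not> n dvd d * j" if "0 < j" "j \<le> m" for j
    using that d m by (intro not_dvd_mult_of_less) (auto simp: less_Suc_eq_le intro: le_trans)
  have Q1: "local_unit ?P (qpoch p p m)"
    unfolding p_def q_def using n0 ndvd by (rule local_unit_qpoch_q)
  have Q2: "local_unit ?P (qpoch (q ^ (d + 1) * x) p m)"
    unfolding p_def q_def x_def using n0 c by (rule local_unit_qpoch_const)
  have "1 - p * p ^ i \<noteq> 0" if "i < m" for i
    using Q1 that by (auto simp: local_unit_def qpoch_def)
  moreover have eq: "q * x * p = q ^ (d + 1) * x" by (simp add: p_def mult_ac)
  moreover have "1 - q * x * p * p ^ i \<noteq> 0" if "i < m" for i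
    unfolding eq using Q2 that by (auto simp: local_unit_def qpoch_def)
  ultimately have "(\<Sum>k = 0..m. (qpoch q p k * qpoch x p k)
       / (qpoch p p k * qpoch (q * x * p) p k) * p ^ k) =
    (qpoch (q * p) p m * qpoch (x * p) p m) / (qpoch p p m * qpoch (q * x * p) p m)"
    by (intro qpoch_sum)
  also have "qpoch (q * p) p m = (1 - q ^ n) * qpoch (q * p) p M"
  proof -
    have "n = 1 + d + d * M" unfolding m M by simp
    hence "q * p * p ^ M = q ^ n" by (simp only: p_def power_mult power_add power_one_right)
    thus ?thesis by (simp add: M qpoch_Suc)
  qed
  finally have closed: "(\<Sum>k = 0..m. (qpoch q p k * qpoch x p k)
       / (qpoch p p k * qpoch (q * x * p) p k) * p ^ k) =
    ((1 - q ^ n) * qpoch (q * p) p M * qpoch (x * p) p m) / (qpoch p p m * qpoch (q * x * p) p m)" .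
  have S: "(\<Sum>k = 0..m. (qpoch q (q ^ d) k * qpoch x (q ^ d) k)
       / (qpoch (q ^ d) (q ^ d) k * qpoch (q ^ (d + 1) * x) (q ^ d) k) * q ^ (d * k)) =
     (1 - q ^ n) * (qpoch (q * p) p M * qpoch (x * p) p m *
       inverse (qpoch p p m * qpoch (q ^ (d + 1) * x) p m))"
    unfolding power_mult p_def[symmetric] closed[unfolded eq]
    by (simp only: divide_inverse mult.assoc)
  obtain C where C: "C \<in> local_ring ?P" "1 - q ^ n = to_fract ?P * C"
    using one_minus_q_power_cyclotomic[OF n0] unfolding q_def by blast
  show ?thesis unfolding S
  proof (rule ratfun_congI)
    show "C * (qpoch (q * p) p M * qpoch (x * p) p m *
       inverse (qpoch p p m * qpoch (q ^ (d + 1) * x) p m)) \<in> local_ring ?P"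
      by (intro local_ring_mult local_ring_qpoch C local_unit_imp_in[OF qu] local_unit_imp_in[OF pu]
          local_unit_imp_in[OF local_unit_inverse] local_unit_mult Q1 Q2)
         (simp add: x_def)
    show "?P \<noteq> 0" using n0 by (rule cyclotomic_nonzero)
  qed (simp add: C(2) mult_ac)
qed

text \<open>Passage to integer exponents, where \<open>local_cong_q_powi\<close> can reduce modulo
  \<open>n\<close>.\<close>

lemma inverse_q_power_eq_powi:
  "inverse ((q ^ d) ^ (\<Sum>i<m. i)) = q powi (- (int d * (\<Sum>i<m. int i)))" for q :: "'a::field"
  by (simp add: power_int_minus flip: power_mult of_nat_mult of_nat_sum)

lemma sum_cong_square:
  fixes d n m :: nat
  defines "q \<equiv> ratfun_q :: 'a::field_char_0 poly fract"
  assumes d2: "d \<ge> 2" and n: "n > 1" and m: "n + 1 = d * m"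
  shows "ratfun_cong
    (\<Sum>k = 0..m. qpoch (inverse q) (q ^ d) k / qpoch (q ^ d) (q ^ d) k * q ^ (d * k))
    ((- 1) ^ (m + 1) * qint q n
       * q powi (((int n)\<^sup>2 - int d * int n + int d - 1) div (2 * int d)))
    (cyclotomic n ^ 2)"
proof -
  let ?P = "cyclotomic n :: 'a poly"
  have n0: "n > 0" using n by simp
  have d: "d > 0" using m by (auto intro!: Nat.gr0I)
  define s where "s = (\<Sum>i<m. int i)"
  define E where "E = ((int n)\<^sup>2 - int d * int n + int d - 1) div (2 * int d)"
  define U where "U = qpoch (q ^ (d - 1)) (q ^ d) (m - 1) / qpoch (q ^ d) (q ^ d) m"
  have nm: "int n = int d * int m - 1"
    using m by (metis add_diff_cancel_right' of_nat_1 of_nat_add of_nat_mult)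
  \<comment> \<open>Exhibits the exponent's numerator as a multiple of \<open>2 * d\<close>, so
    \<open>div\<close> is exact, and splits the quotient into a multiple of \<open>n\<close> and the
    exponent \<open>- d * s\<close> coming from the reversal.\<close>
  have "(int n)\<^sup>2 - int d * int n + int d - 1 = 2 * int d * (int n * (int m - 1)) - int d * int d * (2 * s)"
    unfolding s_def sum_lessThan_id nm by (simp add: algebra_simps power2_eq_square)
  also have "\<dots> = (2 * int d) * (int n * (int m - 1) - int d * s)"
    by (simp add: algebra_simps)
  finally have E: "E = int n * (int m - 1) - int d * s" unfolding E_def using d by simp
  \<comment> \<open>The case \<open>c = 0\<close>, where all factorials containing x equal
    1.\<close>
  have S: "(\<Sum>k = 0..m. qpoch (inverse q) (q ^ d) k / qpoch (q ^ d) (q ^ d) k * q ^ (d * k)) =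
     (1 - q ^ n) * U"
    using sum_closed_form[OF n m, of "0 :: 'a"] n by (simp add: q_def U_def zero_power)
  have qu: "local_unit ?P q" unfolding q_def using n0 by (rule local_unit_ratfun_q)
  have u1: "local_unit ?P (1 - q)"
    using local_unit_one_minus_q_power[of n 1, where 'a = 'a] n by (simp add: q_def)
  have "local_cong ?P U ((- 1) ^ (m + 1) * q powi (- (int d * s)) * inverse (1 - q))"
    using cyclotomic_quotient_cong[OF d2 n m, where 'a = 'a]
    unfolding U_def s_def q_def inverse_q_power_eq_powi divide_inverse .
  \<comment> \<open>The two exponents differ by \<open>n * (m - 1)\<close>.\<close>
  also have "local_cong ?P \<dots> ((- 1) ^ (m + 1) * q powi E * inverse (1 - q))"
    unfolding q_def
    by (intro local_cong_mult local_cong_refl local_cong_q_powi n0 local_unit_imp_in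
        local_unit_mult local_unit_power local_unit_uminus local_unit_one local_unit_powi
        local_unit_inverse qu[unfolded q_def] u1[unfolded q_def]) (simp add: E)
  finally have cong: "local_cong ?P U ((- 1) ^ (m + 1) * q powi E * inverse (1 - q))" .
  \<comment> \<open>The prefactor 1 - q^n contributes one factor \<open>cyclotomic n\<close>; the
    cofactor congruence contributes the second.\<close>
  obtain C where C: "C \<in> local_ring ?P" "1 - q ^ n = to_fract ?P * C"
    using one_minus_q_power_cyclotomic[OF n0] unfolding q_def by blast
  have "(- 1) ^ (m + 1) * qint q n * q powi E =
      (1 - q ^ n) * ((- 1) ^ (m + 1) * q powi E * inverse (1 - q))"
    by (simp add: qint_split mult_ac)
  thus ?thesis unfolding S E_def[symmetric]
    using local_cong_imp_ratfun_cong_mult[OF cong C(1) cyclotomic_nonzero[OF n0]]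
    by (simp only: C(2))
qed

text \<open>The cofactor is now \<open>U * W\<close>: \<open>U\<close> is the quotient from the case
  without x, and \<open>W\<close> the quotient involving x, each reduced modulo
  \<open>cyclotomic n\<close> by its own reversal lemma.\<close>

lemma sum_const_cong_square:
  fixes d n m :: nat and c :: "'a::field_char_0"
  defines "q \<equiv> ratfun_q" and "x \<equiv> to_fract [:c:]"
  assumes d2: "d \<ge> 2" and n: "n > 1" and m: "n + 1 = d * m" and c: "c \<noteq> 0" "c ^ n \<noteq> 1"
  shows "ratfun_cong
    (\<Sum>k = 0..m. (qpoch (inverse q) (q ^ d) k * qpoch x (q ^ d) k)
             / (qpoch (q ^ d) (q ^ d) k * qpoch (q ^ (d - 1) * x) (q ^ d) k) * q ^ (d * k))
    ((- 1) ^ (m + 1) * qint q n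
       * q powi (- (((int n)\<^sup>2 + int d * int n - int d - 1) div (2 * int d)))
       * (qpoch (inverse (q * x)) (q ^ d) m / qpoch (inverse x) (q ^ d) m))
    (cyclotomic n ^ 2)"
proof -
  let ?P = "cyclotomic n :: 'a poly"
  have n0: "n > 0" using n by simp
  have d: "d > 0" using m by (auto intro!: Nat.gr0I)
  define s where "s = (\<Sum>i<m. int i)"
  define E where "E = - (((int n)\<^sup>2 + int d * int n - int d - 1) div (2 * int d))"
  define U where "U = qpoch (q ^ (d - 1)) (q ^ d) (m - 1) / qpoch (q ^ d) (q ^ d) m"
  define W where "W = qpoch (x * q ^ d) (q ^ d) m / qpoch (q ^ (d - 1) * x) (q ^ d) m"
  define R where "R = qpoch (inverse (q * x)) (q ^ d) m / qpoch (inverse x) (q ^ d) m"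
  define V where "V = (- 1) ^ (m + 1) * inverse (1 - q)"
  have nm: "int n = int d * int m - 1"
    using m by (metis add_diff_cancel_right' of_nat_1 of_nat_add of_nat_mult)
  \<comment> \<open>Again the division by \<open>2 * d\<close> is exact. Up to the multiple
    \<open>- n\<close>, the exponent is \<open>m - d * s\<close>: \<open>m\<close> comes from
    \<open>W\<close> and \<open>- d * s\<close> from \<open>U\<close>.\<close>
  have "(int n)\<^sup>2 + int d * int n - int d - 1 = 2 * int d * (int n - int m) + int d * int d * (2 * s)"
    unfolding s_def sum_lessThan_id nm by (simp add: algebra_simps power2_eq_square)
  also have "\<dots> = (2 * int d) * (int n - int m + int d * s)"
    by (simp add: algebra_simps)
  finally have E: "E = int m - int d * s - int n" unfolding E_def using d by simp
  have q0: "q \<noteq> 0" by (simp add: q_def)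
  have qu: "local_unit ?P q" unfolding q_def using n0 by (rule local_unit_ratfun_q)
  have u1: "local_unit ?P (1 - q)"
    using local_unit_one_minus_q_power[of n 1, where 'a = 'a] n by (simp add: q_def)
  have V: "V \<in> local_ring ?P" unfolding V_def
    by (intro local_unit_imp_in local_unit_mult local_unit_power local_unit_uminus local_unit_one
        local_unit_inverse u1)
  have qpow: "q powi k \<in> local_ring ?P" for k
    by (intro local_unit_imp_in local_unit_powi qu)
  have x: "x \<in> local_ring ?P" by (simp add: x_def)
  have W: "W \<in> local_ring ?P" unfolding W_def divide_inverse
    by (intro local_ring_mult local_ring_qpoch local_ring_power x local_unit_imp_in[OF qu]
        local_unit_imp_in[OF local_unit_inverse])
       (unfold q_def x_def, rule local_unit_qpoch_const, use n0 c in auto)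
  have ix: "inverse x = to_fract [:inverse c:]"
    unfolding x_def using c(1) by (rule inverse_to_fract_const)
  have ixl: "inverse x \<in> local_ring ?P" by (simp add: ix)
  have "inverse c ^ n \<noteq> 1" using c by (simp add: power_inverse)
  from local_unit_qpoch_const[OF n0 this, of 0 d m]
  have Q2: "local_unit ?P (qpoch (inverse x) (q ^ d) m)" by (simp add: ix q_def)
  have R: "R \<in> local_ring ?P" unfolding R_def divide_inverse inverse_mult_distrib
    by (intro local_ring_mult local_ring_qpoch local_ring_power ixl local_unit_imp_in[OF qu]
        local_unit_imp_in[OF local_unit_inverse] qu Q2)
  have "local_cong ?P U (V * q powi (- (int d * s)))"
    using cyclotomic_quotient_cong[OF d2 n m, where 'a = 'a]
    unfolding U_def V_def s_def q_def inverse_q_power_eq_powi divide_inverse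
    by (simp only: mult_ac)
  moreover have "local_cong ?P W (q ^ m * R)"
    using const_quotient_cong[OF n0 m c] unfolding W_def R_def q_def x_def .
  ultimately have "local_cong ?P (U * W) ((V * q powi (- (int d * s))) * (q ^ m * R))"
    by (intro local_cong_mult local_ring_mult V W qpow)
  also have "(V * q powi (- (int d * s))) * (q ^ m * R) = V * q powi (int m - int d * s) * R"
    using q0 by (simp add: power_int_diff power_int_minus divide_inverse mult_ac)
  also have "local_cong ?P \<dots> (V * q powi E * R)"
    unfolding q_def
    by (intro local_cong_mult local_cong_refl local_cong_q_powi n0 local_ring_mult
         V R qpow[unfolded q_def]) (simp add: E)
  finally have cong: "local_cong ?P (U * W) (V * q powi E * R)" .
  obtain C where C: "C \<in> local_ring ?P" "1 - q ^ n = to_fract ?P * C"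
    using one_minus_q_power_cyclotomic[OF n0] unfolding q_def by blast
  have S: "(\<Sum>k = 0..m. (qpoch (inverse q) (q ^ d) k * qpoch x (q ^ d) k)
             / (qpoch (q ^ d) (q ^ d) k * qpoch (q ^ (d - 1) * x) (q ^ d) k) * q ^ (d * k)) =
      (1 - q ^ n) * (U * W)"
    using sum_closed_form[OF n m c(2)] by (simp only: q_def x_def U_def W_def)
  have "(- 1) ^ (m + 1) * qint q n * q powi E * R = (1 - q ^ n) * (V * q powi E * R)"
    by (simp add: V_def qint_split mult_ac)
  thus ?thesis unfolding S E_def[symmetric] R_def[symmetric]
    using local_cong_imp_ratfun_cong_mult[OF cong C(1) cyclotomic_nonzero[OF n0]]
    by (simp only: C(2))
qed

section \<open>Specialisation to the four congruences\<close>

lemma cong_minus_one_natE: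
  assumes "[int n = - 1] (mod int d)"
  obtains m where "n + 1 = d * m"
proof -
  have "int d dvd int n - (- 1)" using assms by (simp add: cong_iff_dvd_diff)
  hence "int d dvd int (n + 1)" by (simp add: add.commute)
  hence "d dvd n + 1" by (simp only: int_dvd_int_iff)
  thus ?thesis using that by (auto elim: dvdE)
qed

text \<open>The indeterminate x is a constant with respect to the outer variable; its value
  \<open>c\<close> in the preceding lemmas is the generator of the inner function field.\<close>

lemma ratfun_x_eq: "ratfun_x = to_fract [:ratfun_q:]"
  by (simp add: ratfun_x_def ratfun_q_def to_fract_def)

text \<open>Applied to the inner layer, this provides the hypothesis \<open>c ^ n \<noteq> 1\<close>
  for the indeterminate x.\<close>

lemma ratfun_q_power_neq_one:
  assumes "n > 0"
  shows "ratfun_q ^ n \<noteq> (1 :: 'a::field poly fract)"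
proof
  assume "ratfun_q ^ n = (1 :: 'a poly fract)"
  hence "to_fract (monom 1 n - 1 :: 'a poly) = 0" by (simp add: ratfun_q_power)
  thus False using monom_minus_one_neq_0[OF assms, where 'a = 'a] by (simp only: to_fract_eq_0_iff)
qed

theorem theorem1p2:
  fixes q :: "rat poly fract"
    and Q x :: "rat poly fract poly fract"
  defines "q \<equiv> ratfun_q" and "Q \<equiv> ratfun_q" and "x \<equiv> ratfun_x"
  shows
    "(\<forall>d n :: nat. d \<ge> 2 \<and> n > 1 \<and> odd n \<and> [int n = - 1] (mod int d) \<longrightarrow>
        ratfun_cong
          (\<Sum>k = 0..(n + 1) div d.
             qpoch (inverse q) (q ^ d) k / qpoch (q ^ d) (q ^ d) k * q ^ (d * k))
          ((- 1) ^ ((n + d + 1) div d) * qint q n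
             * q powi (((int n)\<^sup>2 - int d * int n + int d - 1) div (2 * int d)))
          (cyclotomic n ^ 2))
     \<and> (\<forall>d n :: nat. d \<ge> 1 \<and> n > 1 \<and> odd n \<and> [n = 1] (mod (2 * d)) \<longrightarrow>
        ratfun_cong
          (\<Sum>k = 0..(n - 1) div (2 * d).
             qpoch q (q ^ (2 * d)) k / qpoch (q ^ (2 * d)) (q ^ (2 * d)) k * q ^ (2 * d * k))
          0
          (cyclotomic n))
     \<and> (\<forall>d n :: nat. d \<ge> 2 \<and> n > 1 \<and> odd n \<and> [int n = - 1] (mod int d) \<longrightarrow>
        ratfun_cong
          (\<Sum>k = 0..(n + 1) div d.
             (qpoch (inverse Q) (Q ^ d) k * qpoch x (Q ^ d) k)
               / (qpoch (Q ^ d) (Q ^ d) k * qpoch (Q ^ (d - 1) * x) (Q ^ d) k) * Q ^ (d * k))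
          ((- 1) ^ ((n + d + 1) div d) * qint Q n
             * Q powi (- (((int n)\<^sup>2 + int d * int n - int d - 1) div (2 * int d)))
             * (qpoch (inverse (Q * x)) (Q ^ d) ((n + 1) div d)
                  / qpoch (inverse x) (Q ^ d) ((n + 1) div d)))
          (cyclotomic n ^ 2))
     \<and> (\<forall>d n :: nat. d \<ge> 1 \<and> n > 1 \<and> odd n \<and> [n = 1] (mod (2 * d)) \<longrightarrow>
        ratfun_cong
          (\<Sum>k = 0..(n - 1) div (2 * d).
             (qpoch Q (Q ^ (2 * d)) k * qpoch x (Q ^ (2 * d)) k)
               / (qpoch (Q ^ (2 * d)) (Q ^ (2 * d)) k * qpoch (Q ^ (2 * d + 1) * x) (Q ^ (2 * d)) k)
               * Q ^ (2 * d * k))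
          0
          (cyclotomic n))"
proof (intro conjI allI impI; elim conjE)
  fix d n :: nat
  assume d: "d \<ge> 2" and n: "n > 1" and mod: "[int n = - 1] (mod int d)"
  obtain m where m: "n + 1 = d * m" using mod by (rule cong_minus_one_natE)
  have "n + d + 1 = d * (m + 1)" using m by simp
  hence div: "(n + 1) div d = m" "(n + d + 1) div d = m + 1"
    using d by (simp_all only: m) simp_all
  show "ratfun_cong
          (\<Sum>k = 0..(n + 1) div d.
             qpoch (inverse q) (q ^ d) k / qpoch (q ^ d) (q ^ d) k * q ^ (d * k))
          ((- 1) ^ ((n + d + 1) div d) * qint q n
             * q powi (((int n)\<^sup>2 - int d * int n + int d - 1) div (2 * int d)))
          (cyclotomic n ^ 2)"
    unfolding div q_def using d n m by (rule sum_cong_square)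
  show "ratfun_cong
          (\<Sum>k = 0..(n + 1) div d.
             (qpoch (inverse Q) (Q ^ d) k * qpoch x (Q ^ d) k)
               / (qpoch (Q ^ d) (Q ^ d) k * qpoch (Q ^ (d - 1) * x) (Q ^ d) k) * Q ^ (d * k))
          ((- 1) ^ ((n + d + 1) div d) * qint Q n
             * Q powi (- (((int n)\<^sup>2 + int d * int n - int d - 1) div (2 * int d)))
             * (qpoch (inverse (Q * x)) (Q ^ d) ((n + 1) div d)
                  / qpoch (inverse x) (Q ^ d) ((n + 1) div d)))
          (cyclotomic n ^ 2)"
    unfolding div Q_def x_def ratfun_x_eq using d n m
    by (intro sum_const_cong_square ratfun_q_power_neq_one ratfun_q_nonzero) auto
next
  fix d n :: nat
  assume d: "d \<ge> 1" and n: "n > 1" and mod: "[n = 1] (mod (2 * d))"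
  have "2 * d dvd n - 1" using mod n by (simp add: cong_altdef_nat)
  then obtain m where m: "n = 2 * d * m + 1" using n by (metis dvd_def le_add_diff_inverse2 less_imp_le)
  hence div: "(n - 1) div (2 * d) = m" using d by simp
  \<comment> \<open>The sum without x is the instance \<open>c = 0\<close> of
    \<open>sum_vanishes\<close>.\<close>
  have "(0 :: rat) ^ n \<noteq> 1" using n by (simp add: zero_power)
  from sum_vanishes[OF n m this]
  show "ratfun_cong
          (\<Sum>k = 0..(n - 1) div (2 * d).
             qpoch q (q ^ (2 * d)) k / qpoch (q ^ (2 * d)) (q ^ (2 * d)) k * q ^ (2 * d * k))
          0 (cyclotomic n)"
    unfolding div q_def by simp
  show "ratfun_cong
          (\<Sum>k = 0..(n - 1) div (2 * d).
             (qpoch Q (Q ^ (2 * d)) k * qpoch x (Q ^ (2 * d)) k)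
               / (qpoch (Q ^ (2 * d)) (Q ^ (2 * d)) k * qpoch (Q ^ (2 * d + 1) * x) (Q ^ (2 * d)) k)
               * Q ^ (2 * d * k))
          0 (cyclotomic n)"
    unfolding div Q_def x_def ratfun_x_eq using n m
    by (intro sum_vanishes ratfun_q_power_neq_one) auto
qed

end
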